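(* Let $(W,\mathcal{M})$ be a finite coherent social decision frame. Assume that $\mathcal{M}$ is invariant under bijections: for every bijection $i:W\to W$ and every $A\subseteq W$, $A\in\mathcal{M}$ if and only if $i[A]\in\mathcal{M}$. Then $\mathcal{M}=\{A\subseteq W: |A|>\tfrac12|W|\}$.
   Context: A finite social decision frame is a pair $(W,\mathcal{M})$ where $W$ is a nonempty finite set and $\mathcal{M}$ is a family of subsets of $W$. Put $A^c=W\setminus A$ and $\mathcal{H}=\{A\subseteq W: A\notin\mathcal{M}\text{ and }A^c\notin\mathcal{M}\}$. The frame is coherent if for every positive integer $n$ and every sequence $A_1,\dots,A_n$ of subsets of $W$ (repetitions allowed): if (c1) $A_i\in\mathcal{M}\cup\mathcal{H}$ for all $i$, and (c2) every $w\in W$ satisfies $|\{i\le n: w\in A_i\}|\le n/2$; then (c3) $A_i\in\mathcal{H}$ for all $i$, and (c4) every $w\in W$ satisfies $|\{i\le n: w\in A_i\}|= n/2$. *)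

theory Defs
  imports Complex_Main
begin

definition finite_social_decision_frame :: "'a set \<Rightarrow> 'a set set \<Rightarrow> bool" where
  "finite_social_decision_frame W M \<longleftrightarrow> finite W \<and> W \<noteq> {} \<and> M \<subseteq> Pow W"

definition undecided :: "'a set \<Rightarrow> 'a set set \<Rightarrow> 'a set set" where
  "undecided W M = {A. A \<subseteq> W \<and> A \<notin> M \<and> W - A \<notin> M}"

text \<open>
  A sequence of \<open>n\<close> sets is a function whose values at \<open>1, \<dots>, n\<close> matter; it need not be
  injective. The multiplicity bounds are stated over the reals, so \<open>n / 2\<close> is not truncated.
\<close>

definition coherent :: "'a set \<Rightarrow> 'a set set \<Rightarrow> bool" where
  "coherent W M \<longleftrightarrow>
    (\<forall>(n::nat) (A :: nat \<Rightarrow> 'a set).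
      n \<ge> 1 \<longrightarrow>
      (\<forall>i\<in>{1..n}. A i \<subseteq> W) \<longrightarrow>
      (\<forall>i\<in>{1..n}. A i \<in> M \<union> undecided W M) \<longrightarrow>
      (\<forall>w\<in>W. real (card {i\<in>{1..n}. w \<in> A i}) \<le> real n / 2) \<longrightarrow>
      (\<forall>i\<in>{1..n}. A i \<in> undecided W M) \<and>
      (\<forall>w\<in>W. real (card {i\<in>{1..n}. w \<in> A i}) = real n / 2))"

end

theory Submission
  imports Defs "HOL-Number_Theory.Cong"
begin

text \<open>
  The translates of a set \<open>A\<close> under a cyclic permutation of \<open>W\<close> form a sequence of \<open>|W|\<close> sets that
  covers every point exactly \<open>|A|\<close> times. By invariance all of them have the same status as \<open>A\<close>, so
  coherence forces every non-rejected \<open>A\<close> with \<open>|A| \<le> |W|/2\<close> to be undecided with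
  \<open>|A| = |W|/2\<close>. Applying this to \<open>A\<close> and to its complement gives the theorem.
\<close>

text \<open>Cancelling \<open>k\<close> shows that \<open>n\<close> divides the integer difference
  of \<open>a\<close> and \<open>b\<close>, which is too small to be a nonzero multiple. Bounding
  the difference rather than each number serves both for labels in \<open>{0..<n}\<close> and for
  shifts in \<open>{1..n}\<close>.\<close>

lemma add_mod_eq_imp_eq:
  fixes a b k n :: nat
  assumes "(a + k) mod n = (b + k) mod n" and "\<bar>int a - int b\<bar> < int n"
  shows "a = b"
proof -
  have "[a = b] (mod n)"
    using assms(1) by (simp add: cong_def [symmetric] cong_add_rcancel_nat)
  then have "int n dvd int a - int b"
    by (simp add: cong_int_iff [symmetric] cong_iff_dvd_diff)
  then show ?thesis
    using assms(2) dvd_imp_le_int [of "int a - int b" "int n"] by auto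
qed

text \<open>\<open>r k\<close> is addition of \<open>k\<close> modulo \<open>card W\<close>, carried
  over to \<open>W\<close> by a numbering \<open>g\<close> of its points. For fixed \<open>w\<close>
  the shifts from 1 to \<open>card W\<close> form a complete residue system, so each point is hit
  once; this index range is the one in \<open>coherent\<close>.\<close>

lemma simply_transitive_family:
  fixes W :: "'a set"
  assumes "finite W"
  obtains r :: "nat \<Rightarrow> 'a \<Rightarrow> 'a"
    where "\<And>k. bij_betw (r k) W W"
      and "\<And>w. w \<in> W \<Longrightarrow> bij_betw (\<lambda>k. r k w) {1..card W} W"
proof -
  let ?n = "card W"
  obtain g where g: "bij_betw g W {0..<?n}"
    using ex_bij_betw_finite_nat [OF assms] by blast
  let ?f = "the_inv_into W g"
  have f: "bij_betw ?f {0..<?n} W"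
    using g by (rule bij_betw_the_inv_into)
  have lt: "g w < ?n" if "w \<in> W" for w
    using g that bij_betwE by fastforce
  define r where "r k w = ?f ((g w + k) mod ?n)" for k w
  have r_in: "r k w \<in> W" if "w \<in> W" for k w
  proof -
    have "(g w + k) mod ?n \<in> {0..<?n}"
      using lt [OF that] by simp
    then show ?thesis
      using f bij_betwE unfolding r_def by blast
  qed
  have r_eq: "(g v + j) mod ?n = (g w + k) mod ?n"
    if "r j v = r k w" "v \<in> W" "w \<in> W" for j k v w
  proof (rule inj_onD [OF bij_betw_imp_inj_on [OF f]])
    show "?f ((g v + j) mod ?n) = ?f ((g w + k) mod ?n)"
      using that(1) by (simp add: r_def)
  qed (use lt that in force)+
  show thesis
  proof (rule that)
    fix k
    have "inj_on (r k) W"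
    proof (rule inj_onI)
      fix v w assume vw: "v \<in> W" "w \<in> W" "r k v = r k w"
      have "g v = g w"
        by (rule add_mod_eq_imp_eq [OF r_eq [OF vw(3,1,2)]])
          (use lt [OF vw(1)] lt [OF vw(2)] in linarith)
      then show "v = w"
        using g vw by (meson bij_betw_imp_inj_on inj_onD)
    qed
    then show "bij_betw (r k) W W"
      using r_in endo_inj_surj [OF assms] by (simp add: bij_betw_def image_subset_iff)
  next
    fix w assume w: "w \<in> W"
    have inj: "inj_on (\<lambda>k. r k w) {1..?n}"
    proof (rule inj_onI)
      fix j k assume jk: "j \<in> {1..?n}" "k \<in> {1..?n}" "r j w = r k w"
      have "(j + g w) mod ?n = (k + g w) mod ?n"
        using r_eq [OF jk(3) w w] by (simp only: add.commute)
      moreover have "\<bar>int j - int k\<bar> < int ?n"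
        using jk(1,2) unfolding atLeastAtMost_iff by linarith
      ultimately show "j = k"
        by (rule add_mod_eq_imp_eq)
    qed
    have "(\<lambda>k. r k w) ` {1..?n} = W"
    proof (rule card_subset_eq [OF assms])
      show "card ((\<lambda>k. r k w) ` {1..?n}) = ?n"
        by (simp only: card_image [OF inj] card_atLeastAtMost diff_Suc_1 Suc_eq_plus1 [symmetric])
    qed (use r_in [OF w] in auto)
    then show "bij_betw (\<lambda>k. r k w) {1..?n} W"
      using inj by (simp add: bij_betw_def)
  qed
qed

lemma coherent_invariant_small_set:
  fixes W :: "'a set" and M :: "'a set set"
  assumes "finite W" and "W \<noteq> {}" and "coherent W M"
    and inv: "\<And>i A. bij_betw i W W \<Longrightarrow> A \<subseteq> W \<Longrightarrow> A \<in> M \<longleftrightarrow> i ` A \<in> M"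
    and A: "A \<in> M \<union> undecided W M" "A \<subseteq> W" "2 * card A \<le> card W"
  shows "A \<in> undecided W M \<and> 2 * card A = card W"
proof -
  let ?n = "card W"
  obtain r where r: "\<And>k. bij_betw (r k) W W"
    and orbit: "\<And>w. w \<in> W \<Longrightarrow> bij_betw (\<lambda>k. r k w) {1..?n} W"
    using simply_transitive_family [OF assms(1)] by blast
  \<comment> \<open>Preimages instead of images: \<open>w \<in> B k\<close> says that the orbit of
    \<open>w\<close> lies in \<open>A\<close> at index \<open>k\<close>, so the multiplicity of
    \<open>w\<close> can be counted along its orbit.\<close>
  define B where "B k = {w \<in> W. r k w \<in> A}" for k
  have B_sub: "B k \<subseteq> W" for k
    by (auto simp: B_def)
  \<comment> \<open>Being undecided also involves the complement, so invariance is applied to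
    \<open>W - B k\<close> as well.\<close>
  have "r k ` B k = r k ` W \<inter> A" "r k ` (W - B k) = r k ` W - A" for k
    by (auto simp: B_def)
  then have img: "r k ` B k = A" "r k ` (W - B k) = W - A" for k
    using A(2) by (simp_all add: bij_betw_imp_surj_on [OF r] Int_absorb1)
  have "B k \<in> M \<longleftrightarrow> A \<in> M" and "W - B k \<in> M \<longleftrightarrow> W - A \<in> M" for k
    using inv [OF r [of k] B_sub [of k]] inv [OF r [of k] Diff_subset [of W "B k"]] by (simp_all only: img)
  then have same: "B k \<in> M \<longleftrightarrow> A \<in> M" "B k \<in> undecided W M \<longleftrightarrow> A \<in> undecided W M" for k
    using B_sub A(2) by (auto simp: undecided_def)
  have count: "card {k \<in> {1..?n}. w \<in> B k} = card A" if "w \<in> W" for w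
  proof -
    have "(\<lambda>k. r k w) ` {k \<in> {1..?n}. w \<in> B k} = (\<lambda>k. r k w) ` {1..?n} \<inter> A"
      using that by (auto simp: B_def)
    also have "\<dots> = A"
      using A(2) by (simp only: bij_betw_imp_surj_on [OF orbit [OF that]] Int_absorb1)
    finally have "(\<lambda>k. r k w) ` {k \<in> {1..?n}. w \<in> B k} = A" .
    moreover have "inj_on (\<lambda>k. r k w) {k \<in> {1..?n}. w \<in> B k}"
      by (rule inj_on_subset [OF bij_betw_imp_inj_on [OF orbit [OF that]]]) auto
    ultimately show ?thesis
      by (metis card_image)
  qed
  have n: "?n \<ge> 1"
    using assms(1,2) by (simp add: Suc_le_eq card_gt_0_iff)
  \<comment> \<open>Every point has multiplicity \<open>card A\<close>, so (c2) amounts to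
    \<open>2 * card A \<le> card W\<close>.\<close>
  have "(\<forall>k\<in>{1..?n}. B k \<in> undecided W M) \<and>
      (\<forall>w\<in>W. real (card {k\<in>{1..?n}. w \<in> B k}) = real ?n / 2)"
    using assms(3)[unfolded coherent_def, rule_format, of ?n B] n B_sub same A(1,3) count
    by simp
  then have "B 1 \<in> undecided W M" and "\<forall>w\<in>W. real (card A) = real ?n / 2"
    using n count by auto
  then show ?thesis
    using same assms(2) by auto
qed

theorem proposition3p8:
  fixes W :: "'a set" and M :: "'a set set"
  assumes "finite_social_decision_frame W M"
    and "coherent W M"
    and "\<And>i A. bij_betw i W W \<Longrightarrow> A \<subseteq> W \<Longrightarrow> A \<in> M \<longleftrightarrow> i ` A \<in> M"
  shows "M = {A. A \<subseteq> W \<and> real (card A) > 1 / 2 * real (card W)}"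
proof -
  have fin: "finite W" and ne: "W \<noteq> {}" and sub: "M \<subseteq> Pow W"
    using assms(1) by (auto simp: finite_social_decision_frame_def)
  note small = coherent_invariant_small_set [OF fin ne assms(2,3)]
  \<comment> \<open>A member of \<open>M\<close> is not undecided, so the conclusion of
    \<open>small\<close> fails for it and its size hypothesis must fail too.\<close>
  have large: "2 * card A > card W" if "A \<in> M" for A
    using small [of A] that sub by (force simp: undecided_def)
  have "A \<in> M" if A: "A \<subseteq> W" "2 * card A > card W" for A
  proof (rule ccontr)
    assume "A \<notin> M"
    \<comment> \<open>The complement of \<open>W - A\<close> is \<open>A\<close>, which is not in
      \<open>M\<close>, so \<open>W - A\<close> is undecided unless it lies in \<open>M\<close>.
      Either way \<open>small\<close> would give it exactly half of the points, but it has
      fewer.\<close>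
    then have "W - A \<in> M \<union> undecided W M"
      using A(1) by (auto simp: undecided_def double_diff)
    moreover have "2 * card (W - A) < card W"
      using A fin card_mono [OF fin A(1)] by (simp add: card_Diff_subset finite_subset)
    ultimately show False
      using small [of "W - A"] by auto
  qed
  with large sub show ?thesis
    by force
qed

end
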